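(* Let $d\ge1$, let $\mathbf{x}=(x_1,\dots,x_d)$ with each $x_i$ a positive integer, and let $\mathbf{n}=(n_1,\dots,n_d)\in\mathbb{N}^d$. Let $\boldsymbol{Z}=\{z_{\mathbf{k}}:\mathbf{k}\preceq\mathbf{n}\}\subset\mathbb{N}^d$ with $0\le z_{\mathbf{k},i}<x_i$ for all $i$, and such that $z_{\mathbf{k},i}\ge z_{\mathbf{k}',i}$ whenever $\mathbf{k}\preceq\mathbf{k}'\preceq\mathbf{n}$. Define $\boldsymbol{U}=\{u_{\mathbf{k}}:\mathbf{k}\preceq\mathbf{n}\}$ by $u_{\mathbf{k},i}=x_i-z_{\mathbf{k},i}$, and $-\boldsymbol{U}=\{-u_{\mathbf{k}}\}$. Then $$\Big|\bigcup_{P:O\to A}\mathcal{I}_{\mathbf{n}}(P;\boldsymbol{U})\Big|=\frac{1}{\mathbf{n}!}\,\tilde g_{\mathbf{n}}(\mathbf{x};\boldsymbol{Z})=\frac{1}{\mathbf{n}!}\,\tilde g_{\mathbf{n}}((0,\dots,0);-\boldsymbol{U}),$$ where $P$ ranges over all lattice paths from $O=(0,\dots,0)$ to $A=(n_1,\dots,n_d)$ using unit steps $\mathbf{e}_1,\dots,\mathbf{e}_d$.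
   Context: For $\mathbf{k},\mathbf{n}\in\mathbb{N}^d$, $\mathbf{k}\preceq\mathbf{n}$ means $k_i\le n_i$ for all $i$; $\mathbf{n}!=n_1!\cdots n_d!$; $v_{i}$ or $v_{\mathbf{k},i}$ denotes the $i$-th coordinate of a vector; $\mathbf{e}_i$ is the $i$-th standard unit vector. Multivariate difference Gončarov polynomials (over $\mathbb{Q}$): $\Delta_{x_i}p=p(x_1,\dots,x_d)-p(x_1,\dots,x_i-1,\dots,x_d)$; for a node set $\boldsymbol{W}=\{w_{\mathbf{k}}\}$, $\tilde g_{\mathbf{n}}(\mathbf{x};\boldsymbol{W})$ is the unique polynomial of degree at most $n_i$ in $x_i$ for each $i$ such that $\Delta_{x_1}^{k_1}\cdots\Delta_{x_d}^{k_d}\tilde g_{\mathbf{n}}$ evaluated at $w_{\mathbf{k}}$ equals $\mathbf{n}!\,\delta_{\mathbf{k},\mathbf{n}}$ for all $\mathbf{k}\preceq\mathbf{n}$. Combinatorics: $\mathcal{I}(\mathbf{n})$ is the set of $d$-tuples $(\boldsymbol{a}^{(1)},\dots,\boldsymbol{a}^{(d)})$ of non-decreasing integer sequences, $\boldsymbol{a}^{(i)}=(a^{(i)}_0,\dots,a^{(i)}_{n_i-1})$, with $0\le a^{(i)}_j<x_i$. For a lattice path $P=\ell_1\cdots\ell_{n_1+\cdots+n_d}$ from $O$ to $A$ with steps in $\{\mathbf{e}_1,\dots,\mathbf{e}_d\}$, the tuple is bounded by $P$ with respect to $\boldsymbol{U}$ if for every $r$: whenever $\ell_r$ is an $\mathbf{e}_i$-step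 from $\mathbf{k}$ to $\mathbf{k}+\mathbf{e}_i$, then $a^{(i)}_{k_i}<u_{\mathbf{k},i}$. $\mathcal{I}_{\mathbf{n}}(P;\boldsymbol{U})$ is the set of tuples in $\mathcal{I}(\mathbf{n})$ bounded by $P$ with respect to $\boldsymbol{U}$. *)

theory Defs
  imports "HOL-Analysis.Analysis"
begin

text \<open>
  Vectors of length \<open>d\<close> are of type \<open>'a ^ 'd\<close> with \<open>d = CARD('d) \<ge> 1\<close>; the library order on
  \<open>nat ^ 'd\<close> is the componentwise one, and \<open>axis i 1\<close> is the \<open>i\<close>-th standard unit vector.
  Families indexed by \<open>{k. k \<le> n}\<close> are total functions of which only the values at \<open>k \<le> n\<close> matter.
\<close>

definition vfact :: "nat ^ 'd \<Rightarrow> rat" where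
  "vfact n = (\<Prod>i\<in>UNIV. fact (n $ i))"

definition rvec :: "int ^ 'd \<Rightarrow> rat ^ 'd" where
  "rvec v = (\<chi> i. of_int (v $ i))"

text \<open>
  Polynomials in \<open>d\<close> variables over the infinite field of rational numbers are identified with
  the polynomial functions they induce.
\<close>

definition polys_upto :: "nat ^ 'd \<Rightarrow> (rat ^ 'd \<Rightarrow> rat) set" where
  "polys_upto n = {p. \<exists>c :: nat ^ 'd \<Rightarrow> rat.
     \<forall>x. p x = (\<Sum>k\<in>{k. k \<le> n}. c k * (\<Prod>i\<in>UNIV. (x $ i) ^ (k $ i)))}"

lemma finite_vec_atMost: "finite {k :: nat ^ 'd. k \<le> n}"
proof (rule finite_subset)
  show "{k. k \<le> n} \<subseteq> vec_lambda ` (UNIV \<rightarrow>\<^sub>E {..Max (range (($) n))})"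
  proof
    fix k assume "k \<in> {k. k \<le> n}"
    then have "k $ i \<le> Max (range (($) n))" for i
      by (auto simp: less_eq_vec_def intro: order_trans Max_ge)
    then have "($) k \<in> UNIV \<rightarrow>\<^sub>E {..Max (range (($) n))}"
      by auto
    then show "k \<in> vec_lambda ` (UNIV \<rightarrow>\<^sub>E {..Max (range (($) n))})"
      by (metis image_eqI vec_nth_inverse)
  qed
  show "finite (vec_lambda ` (UNIV \<rightarrow>\<^sub>E {..Max (range (($) n))}) :: (nat ^ 'd) set)"
    by (intro finite_imageI finite_PiE) auto
qed

definition bdiff :: "'d \<Rightarrow> (rat ^ 'd \<Rightarrow> rat) \<Rightarrow> rat ^ 'd \<Rightarrow> rat" where
  "bdiff i p = (\<lambda>x. p x - p (x - axis i 1))"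

lemma comp_fun_commute_bdiff:
  fixes k :: "nat ^ 'd"
  shows "comp_fun_commute (\<lambda>i. bdiff i ^^ (k $ i))"
proof
  fix i j :: 'd
  have *: "bdiff i (bdiff j p) = bdiff j (bdiff i p)" for i j :: 'd and p
    by (simp add: bdiff_def fun_eq_iff algebra_simps)
  have **: "(bdiff i ^^ a) (bdiff j p) = bdiff j ((bdiff i ^^ a) p)" for a and p
    by (induction a) (simp_all add: *)
  have "(bdiff i ^^ a) ((bdiff j ^^ b) p) = (bdiff j ^^ b) ((bdiff i ^^ a) p)" for a b and p
    by (induction b) (simp_all add: **)
  then show "(bdiff j ^^ (k $ j)) \<circ> (bdiff i ^^ (k $ i)) = (bdiff i ^^ (k $ i)) \<circ> (bdiff j ^^ (k $ j))"
    by (simp add: fun_eq_iff)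
qed

text \<open>
  The composition of the operators \<open>bdiff i ^^ (k $ i)\<close> over all coordinates \<open>i\<close>. The order does
  not matter by \<open>comp_fun_commute_bdiff\<close>.
\<close>

definition bdiffs :: "nat ^ 'd \<Rightarrow> (rat ^ 'd \<Rightarrow> rat) \<Rightarrow> rat ^ 'd \<Rightarrow> rat" where
  "bdiffs k p = Finite_Set.fold (\<lambda>i. bdiff i ^^ (k $ i)) p UNIV"

definition goncarov :: "nat ^ 'd \<Rightarrow> (nat ^ 'd \<Rightarrow> rat ^ 'd) \<Rightarrow> rat ^ 'd \<Rightarrow> rat" where
  "goncarov n w = (THE g. g \<in> polys_upto n \<and>
     (\<forall>k\<le>n. bdiffs k g (w k) = (if k = n then vfact n else 0)))"

definition sequence_tuples :: "int ^ 'd \<Rightarrow> nat ^ 'd \<Rightarrow> ('d \<Rightarrow> int list) set" where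
  "sequence_tuples x n =
     {a. \<forall>i. length (a i) = n $ i \<and> sorted (a i) \<and> set (a i) \<subseteq> {0..<x $ i}}"

definition lattice_paths :: "nat ^ 'd \<Rightarrow> (nat ^ 'd) list set" where
  "lattice_paths n = {P. set P \<subseteq> range (\<lambda>i. axis i 1) \<and> sum_list P = n}"

text \<open>
  The step \<open>P ! r\<close> starts at the lattice point \<open>sum_list (take r P)\<close>.
\<close>

definition bounded_by :: "(nat ^ 'd) list \<Rightarrow> (nat ^ 'd \<Rightarrow> int ^ 'd) \<Rightarrow> ('d \<Rightarrow> int list) \<Rightarrow> bool" where
  "bounded_by P U a \<longleftrightarrow> (\<forall>r<length P. \<forall>i. P ! r = axis i 1 \<longrightarrow>
     (let k = sum_list (take r P) in a i ! (k $ i) < U k $ i))"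

definition bounded_tuples ::
  "int ^ 'd \<Rightarrow> nat ^ 'd \<Rightarrow> (nat ^ 'd) list \<Rightarrow> (nat ^ 'd \<Rightarrow> int ^ 'd) \<Rightarrow> ('d \<Rightarrow> int list) set" where
  "bounded_tuples x n P U = {a \<in> sequence_tuples x n. bounded_by P U a}"

end

theory Submission
  imports Defs
begin

text \<open>
  Fix a tuple \<open>a\<close> and call a lattice point reachable if some path leading to it bounds \<open>a\<close>. Since
  \<open>U\<close> is monotone, the reachable points below \<open>n\<close> have a greatest element \<open>m\<close>; the entries of \<open>a\<close>
  before \<open>m\<close> form a tuple bounded by a path to \<open>m\<close>, while the remaining ones are arbitrary sorted
  sequences with \<open>i\<close>-th entries in \<open>{U m $ i..<x $ i}\<close>, an interval of length \<open>z m $ i\<close>. With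
  \<open>h t l = pochhammer t l / fact l\<close> counting sorted sequences of length \<open>l\<close> over \<open>t\<close> letters, this gives
  \<open>(\<Prod>i. h (x $ i) (n $ i)) = (\<Sum>m\<le>n. F m * (\<Prod>i. h (z m $ i) (n $ i - m $ i)))\<close> for the numbers
  \<open>F m\<close> to be computed. The normalised Goncarov polynomials satisfy the same triangular recursion,
  because backward differences lower the index of the polynomials \<open>h\<close>.
\<close>

section \<open>Polynomials in several variables\<close>

text \<open>\<open>b t l\<close> is the value at \<open>t\<close> of the \<open>l\<close>-th member
  of a basis. With \<open>b\<close> a parameter, the monomials and the polynomials
  \<open>rising\<close> share all lemmas; \<open>vspan\<close> is the version in several
  variables.\<close>

definition uspan :: "(rat \<Rightarrow> nat \<Rightarrow> rat) \<Rightarrow> nat \<Rightarrow> (rat \<Rightarrow> rat) set" where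
  "uspan b j = {f. \<exists>a. \<forall>t. f t = (\<Sum>l\<le>j. a l * b t l)}"

definition vspan :: "(rat \<Rightarrow> nat \<Rightarrow> rat) \<Rightarrow> nat ^ 'd \<Rightarrow> (rat ^ 'd \<Rightarrow> rat) set" where
  "vspan b n = {p. \<exists>c :: nat ^ 'd \<Rightarrow> rat.
     \<forall>x. p x = (\<Sum>k\<in>{k. k \<le> n}. c k * (\<Prod>i\<in>UNIV. b (x $ i) (k $ i)))}"

lemma polys_upto_eq_vspan: "polys_upto n = vspan (\<lambda>t l. t ^ l) n"
  by (simp add: polys_upto_def vspan_def)

text \<open>The recurrence says that multiplication by \<open>t\<close> takes the
  \<open>l\<close>-th basis member into the span of the members \<open>l\<close> and
  \<open>l + 1\<close>, so a linear factor raises the bound by one.\<close>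

lemma uspan_times_linear:
  assumes rec: "\<And>t l. t * b t l = \<alpha> l * b t (Suc l) + \<beta> l * b t l"
    and "f \<in> uspan b j"
  shows "(\<lambda>t. f t * (t + c)) \<in> uspan b (Suc j)"
proof -
  obtain a where a: "\<And>t. f t = (\<Sum>l\<le>j. a l * b t l)"
    using assms(2) by (auto simp: uspan_def)
  \<comment> \<open>The first summand collects the contributions moved up by one index, hence 0 at
    index 0; the second is cut off at \<open>j\<close>, beyond which \<open>a\<close> is
    arbitrary.\<close>
  define a' where "a' l = (case l of 0 \<Rightarrow> 0 | Suc l' \<Rightarrow> a l' * \<alpha> l')
      + (if l \<le> j then a l * (\<beta> l + c) else 0)" for l
  have "f t * (t + c) = (\<Sum>l\<le>Suc j. a' l * b t l)" for t
  proof -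
    have "f t * (t + c) = (\<Sum>l\<le>j. a l * (t * b t l) + a l * c * b t l)"
      by (simp add: a sum_distrib_right) (simp add: distrib_left distrib_right mult_ac)
    also have "\<dots> = (\<Sum>l\<le>j. a l * \<alpha> l * b t (Suc l)) + (\<Sum>l\<le>j. a l * (\<beta> l + c) * b t l)"
      by (simp add: rec sum.distrib[symmetric] algebra_simps)
    also have "(\<Sum>l\<le>j. a l * \<alpha> l * b t (Suc l)) =
        (\<Sum>l\<le>Suc j. (case l of 0 \<Rightarrow> 0 | Suc l' \<Rightarrow> a l' * \<alpha> l') * b t l)"
      by (subst sum.atMost_Suc_shift) simp
    also have "(\<Sum>l\<le>j. a l * (\<beta> l + c) * b t l) =
        (\<Sum>l\<le>Suc j. (if l \<le> j then a l * (\<beta> l + c) else 0) * b t l)"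
      by simp
    finally show ?thesis
      by (simp only: a'_def distrib_right sum.distrib)
  qed
  then show ?thesis
    by (auto simp: uspan_def)
qed

lemma prod_linear_in_uspan:
  assumes "\<And>t l. t * b t l = \<alpha> l * b t (Suc l) + \<beta> l * b t l"
    and "\<And>t. b t 0 = 1"
  shows "(\<lambda>t. \<Prod>l<j. t + c l) \<in> uspan b j"
proof (induction j)
  case 0
  show ?case
    by (auto simp: uspan_def assms(2) intro: exI[of _ "\<lambda>_. 1"])
next
  case (Suc j)
  show ?case
    using uspan_times_linear[OF assms(1) Suc, of "c j"] by simp
qed

text \<open>Multiplying out the product gives one term for each choice of indices at most
  \<open>k $ i\<close>, and these choices are exactly the vectors below \<open>k\<close>.\<close>

lemma prod_in_vspan:
  fixes k :: "nat ^ 'd"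
  assumes "\<And>i. f i \<in> uspan b (k $ i)"
  shows "(\<lambda>x. \<Prod>i\<in>UNIV. f i (x $ i)) \<in> vspan b k"
proof -
  obtain a where a: "\<And>i t. f i t = (\<Sum>l\<le>k $ i. a i l * b t l)"
    using assms unfolding uspan_def by simp metis
  have "(\<Prod>i\<in>UNIV. f i (x $ i)) =
      (\<Sum>m\<in>{m. m \<le> k}. (\<Prod>i\<in>UNIV. a i (m $ i)) * (\<Prod>i\<in>UNIV. b (x $ i) (m $ i)))" for x
  proof -
    have "(\<Prod>i\<in>UNIV. f i (x $ i)) =
        (\<Sum>g\<in>PiE UNIV (\<lambda>i. {..k $ i}). \<Prod>i\<in>UNIV. a i (g i) * b (x $ i) (g i))"
      unfolding a by (rule prod_sum_PiE) auto
    also have "\<dots> = (\<Sum>m\<in>{m. m \<le> k}. \<Prod>i\<in>UNIV. a i (m $ i) * b (x $ i) (m $ i))"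
      by (rule sum.reindex_bij_witness[of _ vec_nth vec_lambda])
        (auto simp: less_eq_vec_def PiE_def Pi_def)
    finally show ?thesis
      by (simp add: prod.distrib)
  qed
  then show ?thesis
    unfolding vspan_def by (intro CollectI exI allI)
qed

lemma vspan_zero: "(\<lambda>x. 0) \<in> vspan b n"
  by (auto simp: vspan_def intro: exI[of _ "\<lambda>_. 0"])

lemma vspan_linear:
  assumes "p \<in> vspan b n" "q \<in> vspan b n"
  shows "(\<lambda>x. r * p x + s * q x) \<in> vspan b n"
proof -
  obtain c c' where
    "\<And>x. p x = (\<Sum>k\<in>{k. k \<le> n}. c k * (\<Prod>i\<in>UNIV. b (x $ i) (k $ i)))"
    "\<And>x. q x = (\<Sum>k\<in>{k. k \<le> n}. c' k * (\<Prod>i\<in>UNIV. b (x $ i) (k $ i)))"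
    using assms by (auto simp: vspan_def)
  then show ?thesis
    by (auto simp: vspan_def sum_distrib_left sum.distrib[symmetric] algebra_simps
        intro!: exI[of _ "\<lambda>k. r * c k + s * c' k"])
qed

lemma vspan_sum:
  assumes "finite M" "\<And>m. m \<in> M \<Longrightarrow> f m \<in> vspan b n"
  shows "(\<lambda>x. \<Sum>m\<in>M. c m * f m x) \<in> vspan b n"
  using assms
proof (induction M rule: finite_induct)
  case empty
  show ?case by (simp add: vspan_zero)
next
  case (insert m M)
  then show ?case
    using vspan_linear[of "f m" b n "\<lambda>x. \<Sum>m\<in>M. c m * f m x" "c m" 1] by simp
qed

lemma vspan_mono:
  assumes "m \<le> n"
  shows "vspan b m \<subseteq> vspan b n"
proof
  fix p assume "p \<in> vspan b m"
  then obtain c where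
    c: "\<And>x. p x = (\<Sum>k\<in>{k. k \<le> m}. c k * (\<Prod>i\<in>UNIV. b (x $ i) (k $ i)))"
    by (auto simp: vspan_def)
  have "p x = (\<Sum>k\<in>{k. k \<le> n}. (if k \<le> m then c k else 0) * (\<Prod>i\<in>UNIV. b (x $ i) (k $ i)))" for x
    unfolding c using assms
    by (intro sum.mono_neutral_cong_left) (auto simp: finite_vec_atMost)
  then show "p \<in> vspan b n"
    unfolding vspan_def by (intro CollectI exI allI)
qed

lemma vspan_subset:
  fixes n :: "nat ^ 'd"
  assumes "\<And>k. k \<le> n \<Longrightarrow> (\<lambda>x. \<Prod>i\<in>UNIV. b (x $ i) (k $ i)) \<in> vspan b' k"
  shows "vspan b n \<subseteq> vspan b' n"
proof
  fix p assume "p \<in> vspan b n"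
  then obtain c where
    c: "p = (\<lambda>x. \<Sum>k\<in>{k. k \<le> n}. c k * (\<Prod>i\<in>UNIV. b (x $ i) (k $ i)))"
    by (auto simp: vspan_def)
  show "p \<in> vspan b' n"
    unfolding c
    by (intro vspan_sum[where f = "\<lambda>k x. \<Prod>i\<in>UNIV. b (x $ i) (k $ i)"])
      (auto simp: finite_vec_atMost intro: assms vspan_mono[THEN subsetD])
qed

lemma prod_linear_in_polys_upto:
  "(\<lambda>x. \<Prod>i\<in>UNIV. \<Prod>l<k $ i. x $ i + c i l) \<in> polys_upto k"
  unfolding polys_upto_eq_vspan
  by (rule prod_in_vspan, rule prod_linear_in_uspan[of _ "\<lambda>_. 1" "\<lambda>_. 0"]) auto

lemma polys_upto_shift:
  assumes "p \<in> polys_upto n"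
  shows "(\<lambda>x. p (x + v)) \<in> polys_upto n"
proof -
  obtain c where
    c: "p = (\<lambda>x. \<Sum>k\<in>{k. k \<le> n}. c k * (\<Prod>i\<in>UNIV. (x $ i) ^ (k $ i)))"
    using assms by (auto simp: polys_upto_def)
  have "(\<lambda>x. \<Prod>i\<in>UNIV. ((x + v) $ i) ^ (k $ i)) \<in> polys_upto n" if "k \<le> n" for k
    using prod_linear_in_polys_upto[where k = k and c = "\<lambda>i _. v $ i"] vspan_mono[OF that]
    by (auto simp: polys_upto_eq_vspan)
  then show ?thesis
    unfolding c polys_upto_eq_vspan
    by (intro vspan_sum[where f = "\<lambda>k x. \<Prod>i\<in>UNIV. ((x + v) $ i) ^ (k $ i)"])
      (auto simp: finite_vec_atMost)
qed

section \<open>Rising factorials and backward differences\<close>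

text \<open>The multiset coefficient, binomial of \<open>t + l - 1\<close> over \<open>l\<close>, as
  a polynomial in \<open>t\<close>.\<close>

definition rising :: "rat \<Rightarrow> nat \<Rightarrow> rat" where
  "rising t l = pochhammer t l / fact l"

lemma rising_0 [simp]: "rising t 0 = 1"
  by (simp add: rising_def)

lemma rising_0_Suc [simp]: "rising 0 (Suc l) = 0"
  by (simp add: rising_def pochhammer_rec)

text \<open>Pascal's rule: both rising factorials contain \<open>pochhammer t l\<close>, with
  cofactors \<open>t + l\<close> and \<open>t - 1\<close> that differ by
  \<open>l + 1\<close>.\<close>

lemma rising_diff: "rising t (Suc l) - rising (t - 1) (Suc l) = rising t l"
proof -
  have "pochhammer (t - 1) (Suc l) = (t - 1) * pochhammer t l"
    by (simp add: pochhammer_rec)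
  then have "pochhammer t (Suc l) - pochhammer (t - 1) (Suc l) = of_nat (Suc l) * pochhammer t l"
    by (simp add: pochhammer_Suc algebra_simps)
  then have "rising t (Suc l) - rising (t - 1) (Suc l) = of_nat (Suc l) * pochhammer t l / fact (Suc l)"
    by (simp only: rising_def diff_divide_distrib[symmetric])
  then show ?thesis
    by (simp add: rising_def del: of_nat_Suc)
qed

lemma times_rising: "t * rising t l = of_nat (Suc l) * rising t (Suc l) + (- of_nat l) * rising t l"
proof -
  have "of_nat (Suc l) * rising t (Suc l) = pochhammer t (Suc l) / fact l"
    by (simp add: rising_def del: of_nat_Suc)
  then show ?thesis
    by (simp add: rising_def pochhammer_Suc field_simps)
qed

definition vrising :: "nat ^ 'd \<Rightarrow> rat ^ 'd \<Rightarrow> rat" where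
  "vrising k x = (\<Prod>i\<in>UNIV. rising (x $ i) (k $ i))"

lemma vrising_0 [simp]: "vrising 0 x = 1"
  by (simp add: vrising_def)

lemma vrising_in_polys_upto: "vrising k \<in> polys_upto k"
proof -
  \<comment> \<open>The summand \<open>0 * 0\<close> gives the shape of a linear combination with
    the zero polynomial, as in \<open>vspan_linear\<close>.\<close>
  have "vrising k = (\<lambda>x. inverse (vfact k) * (\<Prod>i\<in>UNIV. \<Prod>l<k $ i. x $ i + of_nat l) + 0 * 0)"
    by (simp add: fun_eq_iff vrising_def rising_def vfact_def pochhammer_prod prod_dividef
        atLeast0LessThan field_simps)
  also have "\<dots> \<in> polys_upto k"
    unfolding polys_upto_eq_vspan
    by (rule vspan_linear[OF _ vspan_zero],
        rule prod_linear_in_polys_upto[where c = "\<lambda>_. of_nat", unfolded polys_upto_eq_vspan])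
  finally show ?thesis .
qed

text \<open>The power \<open>t ^ j\<close> is a product of \<open>j\<close> linear factors with
  constant term 0, so the recurrence \<open>times_rising\<close> expands it.\<close>

lemma polys_upto_subset_vspan_rising: "polys_upto n \<subseteq> vspan rising n"
  unfolding polys_upto_eq_vspan
proof (rule vspan_subset)
  fix k :: "nat ^ 'a"
  have "(\<lambda>t. t ^ j) \<in> uspan rising j" for j
    using prod_linear_in_uspan[where b = rising and c = "\<lambda>_. 0", OF times_rising] by simp
  then show "(\<lambda>x. \<Prod>i\<in>UNIV. x $ i ^ k $ i) \<in> vspan rising k"
    by (intro prod_in_vspan)
qed

text \<open>Only the \<open>i\<close>-th factor sees the shift, and \<open>rising_diff\<close>
  lowers its index; at index 0 it is constant, hence the case split.\<close>

lemma bdiff_vrising: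
  "bdiff i (vrising k) =
    (if k $ i = 0 then (\<lambda>_. 0) else vrising (\<chi> j. if j = i then k $ i - 1 else k $ j))"
proof
  fix x :: "rat ^ 'a"
  have fact: "vrising k y = rising (y $ i) (k $ i) * (\<Prod>j\<in>UNIV - {i}. rising (y $ j) (k $ j))"
    for k :: "nat ^ 'a" and y
    by (simp add: vrising_def prod.remove[of UNIV i])
  have rest: "(\<Prod>j\<in>UNIV - {i}. rising ((x - axis i 1) $ j) (k $ j)) =
      (\<Prod>j\<in>UNIV - {i}. rising (x $ j) (k $ j))"
    by (intro prod.cong) (auto simp: axis_def)
  show "bdiff i (vrising k) x =
    (if k $ i = 0 then (\<lambda>_. 0) else vrising (\<chi> j. if j = i then k $ i - 1 else k $ j)) x"
  proof (cases "k $ i")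
    case 0
    then show ?thesis
      unfolding bdiff_def fact rest by simp
  next
    case (Suc l)
    have "bdiff i (vrising k) x =
        (rising (x $ i) (Suc l) - rising (x $ i - 1) (Suc l)) * (\<Prod>j\<in>UNIV - {i}. rising (x $ j) (k $ j))"
      unfolding bdiff_def fact rest Suc by (simp add: algebra_simps)
    also have "\<dots> = vrising (\<chi> j. if j = i then k $ i - 1 else k $ j) x"
      unfolding rising_diff by (simp add: fact Suc)
    finally show ?thesis
      by (simp add: Suc)
  qed
qed

lemma bdiff_zero [simp]: "bdiff i (\<lambda>_. 0) = (\<lambda>_. 0)"
  by (simp add: bdiff_def)

lemma bdiff_power_zero [simp]: "(bdiff i ^^ r) (\<lambda>_. 0) = (\<lambda>_. 0)"
  by (induction r) simp_all

lemma bdiff_power_vrising: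
  "(bdiff i ^^ r) (vrising k) =
    (if r \<le> k $ i then vrising (\<chi> j. if j = i then k $ i - r else k $ j) else (\<lambda>_. 0))"
proof (induction r)
  case 0
  have "(\<chi> j. if j = i then k $ i - 0 else k $ j) = k"
    by (simp add: vec_eq_iff)
  then show ?case by (simp only: funpow_0 le0 if_True)
next
  case (Suc r)
  have "(\<chi> j. if j = i then (\<chi> j. if j = i then k $ i - r else k $ j) $ i - 1 else (\<chi> j. if j = i then k $ i - r else k $ j) $ j) =
      (\<chi> j. if j = i then k $ i - Suc r else k $ j)"
    by (simp add: vec_eq_iff)
  with Suc show ?case
    by (auto simp: bdiff_vrising)
qed

section \<open>Mixed differences over all coordinates\<close>

context
  fixes k :: "nat ^ 'd"
begin

interpretation comp_fun_commute "\<lambda>i. bdiff i ^^ (k $ i)"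
  by (rule comp_fun_commute_bdiff)

text \<open>The polynomials \<open>vrising\<close> behave under backward differences as divided
  powers do under derivatives. The fold is evaluated over arbitrary sets \<open>A\<close> of
  coordinates to allow induction.\<close>

lemma bdiffs_vrising:
  "bdiffs k (vrising n) = (if k \<le> n then vrising (n - k) else (\<lambda>_. 0))"
proof -
  have "Finite_Set.fold (\<lambda>i. bdiff i ^^ (k $ i)) (vrising n) A =
      (if \<forall>i\<in>A. k $ i \<le> n $ i then vrising (\<chi> j. if j \<in> A then n $ j - k $ j else n $ j)
       else (\<lambda>_. 0))" for A
  proof (induction A rule: finite_induct[OF finite])
    case 1
    then show ?case by simp
  next
    case (2 i A)
    have "(\<chi> j. if j = i then (\<chi> j. if j \<in> A then n $ j - k $ j else n $ j) $ i - k $ i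
           else (\<chi> j. if j \<in> A then n $ j - k $ j else n $ j) $ j) =
        (\<chi> j. if j \<in> insert i A then n $ j - k $ j else n $ j)"
      using 2(2) by (simp add: vec_eq_iff)
    with 2 show ?case
      by (auto simp: bdiff_power_vrising)
  qed
  from this[of UNIV] show ?thesis
    unfolding bdiffs_def by (simp add: less_eq_vec_def minus_vec_def)
qed

lemma bdiffs_sum:
  "bdiffs k (\<lambda>x. \<Sum>m\<in>M. c m * f m x) = (\<lambda>x. \<Sum>m\<in>M. c m * bdiffs k (f m) x)"
proof -
  have step: "(bdiff i ^^ r) (\<lambda>x. \<Sum>m\<in>M. c m * f m x) = (\<lambda>x. \<Sum>m\<in>M. c m * (bdiff i ^^ r) (f m) x)"
    for i r and f :: "_ \<Rightarrow> rat ^ 'd \<Rightarrow> rat"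
  proof (induction r)
    case (Suc r)
    then show ?case
      by (simp add: bdiff_def sum_subtractf[symmetric] algebra_simps)
  qed simp
  have "Finite_Set.fold (\<lambda>i. bdiff i ^^ (k $ i)) (\<lambda>x. \<Sum>m\<in>M. c m * f m x) A =
      (\<lambda>x. \<Sum>m\<in>M. c m * Finite_Set.fold (\<lambda>i. bdiff i ^^ (k $ i)) (f m) A x)" for A
    by (induction A rule: finite_induct[OF finite]) (simp_all add: step)
  then show ?thesis
    by (simp add: bdiffs_def)
qed

lemma bdiffs_shift: "bdiffs k (\<lambda>x. p (x + v)) = (\<lambda>x. bdiffs k p (x + v))"
proof -
  have step: "(bdiff i ^^ r) (\<lambda>x. p (x + v)) = (\<lambda>x. (bdiff i ^^ r) p (x + v))"
    for i r and p :: "rat ^ 'd \<Rightarrow> rat"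
    by (induction r) (simp_all add: bdiff_def algebra_simps)
  have "Finite_Set.fold (\<lambda>i. bdiff i ^^ (k $ i)) (\<lambda>x. p (x + v)) A =
      (\<lambda>x. Finite_Set.fold (\<lambda>i. bdiff i ^^ (k $ i)) p A (x + v))" for A
    by (induction A rule: finite_induct[OF finite]) (simp_all add: step)
  then show ?thesis
    by (simp add: bdiffs_def)
qed

end

lemma bdiffs_linear:
  "bdiffs k (\<lambda>x. r * p x + s * q x) = (\<lambda>x. r * bdiffs k p x + s * bdiffs k q x)"
  \<comment> \<open>\<open>bool\<close> serves as an index set of two elements, one for
    \<open>p\<close> and one for \<open>q\<close>.\<close>
  using bdiffs_sum[where M = UNIV and c = "\<lambda>m. if m then r else s" and f = "\<lambda>m. if m then p else q" and k = k]
  by (simp add: UNIV_bool add.commute)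

section \<open>Goncarov polynomials\<close>

lemma finite_vec_lessThan: "finite {m :: nat ^ 'd. m < n}"
  by (rule finite_subset[OF _ finite_vec_atMost[of n]]) auto

lemma vec_le_imp_sum_le:
  fixes m n :: "nat ^ 'd"
  shows "m \<le> n \<Longrightarrow> (\<Sum>i\<in>UNIV. m $ i) \<le> (\<Sum>i\<in>UNIV. n $ i)"
  by (auto simp: less_eq_vec_def intro: sum_mono)

lemma vec_less_imp_sum_less:
  fixes m n :: "nat ^ 'd"
  assumes "m < n"
  shows "(\<Sum>i\<in>UNIV. m $ i) < (\<Sum>i\<in>UNIV. n $ i)"
  using assms by (intro sum_strict_mono_ex1) (auto simp: less_vec_def less_eq_vec_def not_le)

text \<open>In the basis \<open>vrising\<close> the conditions are unitriangular: condition
  \<open>k\<close> involves only the coefficients with index \<open>m \<ge> k\<close>, with factor 1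
  at \<open>m = k\<close>.\<close>

lemma interpolation_zero:
  fixes n :: "nat ^ 'd"
  assumes p: "p \<in> polys_upto n" and zero: "\<And>k. k \<le> n \<Longrightarrow> bdiffs k p (w k) = 0"
  shows "p = (\<lambda>_. 0)"
proof -
  obtain c where "p = (\<lambda>x. \<Sum>k\<in>{k. k \<le> n}. c k * (\<Prod>i\<in>UNIV. rising (x $ i) (k $ i)))"
    using subsetD[OF polys_upto_subset_vspan_rising p] by (auto simp: vspan_def)
  then have c: "p = (\<lambda>x. \<Sum>k\<in>{k. k \<le> n}. c k * vrising k x)"
    by (simp add: vrising_def)
  have "c k = 0" if "k \<le> n" for k
    using that
  \<comment> \<open>Coefficients are eliminated from \<open>n\<close> downwards, so the measure is
    the distance of \<open>k\<close> from \<open>n\<close>.\<close>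
  proof (induction "(\<Sum>i\<in>UNIV. n $ i) - (\<Sum>i\<in>UNIV. k $ i)" arbitrary: k rule: less_induct)
    case less
    have "0 = bdiffs k p (w k)"
      using zero less.prems by simp
    also have "\<dots> = (\<Sum>m\<in>{m. m \<le> n}. c m * bdiffs k (vrising m) (w k))"
      unfolding c bdiffs_sum ..
    also have "\<dots> = (\<Sum>m\<in>{m. m \<le> n}. if m = k then c k else 0)"
    proof (rule sum.cong)
      fix m assume "m \<in> {m. m \<le> n}"
      then have m: "m \<le> n" by simp
      show "c m * bdiffs k (vrising m) (w k) = (if m = k then c k else 0)"
      proof (cases "k < m")
        case True
        have "c m = 0"
          by (rule less.hyps[OF _ m]) (use vec_less_imp_sum_less[OF True] vec_le_imp_sum_le[OF m] in linarith)
        with True show ?thesis by simp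
      next
        case False
        then show ?thesis
          by (auto simp: bdiffs_vrising order.order_iff_strict)
      qed
    qed simp
    also have "\<dots> = c k"
      using less.prems by (simp add: finite_vec_atMost)
    finally show ?case by simp
  qed
  then show ?thesis
    by (simp add: c)
qed

text \<open>Two solutions differ by a polynomial with zero interpolation data, to which
  \<open>interpolation_zero\<close> applies.\<close>

lemma goncarov_eqI:
  assumes "g \<in> polys_upto n"
    and "\<And>k. k \<le> n \<Longrightarrow> bdiffs k g (w k) = (if k = n then vfact n else 0)"
  shows "goncarov n w = g"
  unfolding goncarov_def
proof (rule the_equality)
  show "g \<in> polys_upto n \<and> (\<forall>k\<le>n. bdiffs k g (w k) = (if k = n then vfact n else 0))"
    using assms by blast
next
  fix g' assume g': "g' \<in> polys_upto n \<and> (\<forall>k\<le>n. bdiffs k g' (w k) = (if k = n then vfact n else 0))"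
  have "(\<lambda>x. 1 * g' x + (-1) * g x) = (\<lambda>_. 0)"
  proof (rule interpolation_zero)
    show "(\<lambda>x. 1 * g' x + (-1) * g x) \<in> polys_upto n"
      using g' assms(1) unfolding polys_upto_eq_vspan by (intro vspan_linear) auto
    show "bdiffs k (\<lambda>x. 1 * g' x + (-1) * g x) (w k) = 0" if "k \<le> n" for k
      unfolding bdiffs_linear using g' assms(2) that by simp
  qed
  then show "g' = g"
    by (simp add: fun_eq_iff)
qed

text \<open>Obtained by solving the identity \<open>goncarov_rec_sum\<close> for its term at
  \<open>m = n\<close>, whose coefficient is 1. These turn out to be the Goncarov polynomials
  divided by \<open>vfact n\<close>.\<close>

function goncarov_rec :: "(nat ^ 'd \<Rightarrow> rat ^ 'd) \<Rightarrow> nat ^ 'd \<Rightarrow> rat ^ 'd \<Rightarrow> rat" where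
  "goncarov_rec w n =
    (\<lambda>x. vrising n x - (\<Sum>m\<in>{m. m < n}. vrising (n - m) (w m) * goncarov_rec w m x))"
  by auto
termination
  by (relation "Wellfounded.measure (\<lambda>(w, n). \<Sum>i\<in>UNIV. n $ i)") (auto intro: vec_less_imp_sum_less)

declare goncarov_rec.simps [simp del]

lemma goncarov_rec_sum:
  "vrising n x = (\<Sum>m\<in>{m. m \<le> n}. vrising (n - m) (w m) * goncarov_rec w m x)"
proof -
  have "{m. m \<le> n} = insert n {m. m < n}"
    by auto
  then show ?thesis
    by (simp add: finite_vec_lessThan goncarov_rec.simps[of w n])
qed

lemma goncarov_rec_in_polys_upto: "goncarov_rec w n \<in> polys_upto n"
proof (induction "\<Sum>i\<in>UNIV. n $ i" arbitrary: n rule: less_induct)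
  case less
  let ?s = "\<lambda>x. \<Sum>m\<in>{m. m < n}. vrising (n - m) (w m) * goncarov_rec w m x"
  have "?s \<in> polys_upto n"
    unfolding polys_upto_eq_vspan
  proof (rule vspan_sum)
    show "finite {m. m < n}"
      by (rule finite_vec_lessThan)
    fix m assume "m \<in> {m. m < n}"
    then show "goncarov_rec w m \<in> vspan (\<lambda>t l. t ^ l) n"
      using less[of m] vec_less_imp_sum_less[of m n] vspan_mono[of m n "\<lambda>t l. t ^ l"]
      by (auto simp: polys_upto_eq_vspan less_imp_le)
  qed
  then have "(\<lambda>x. 1 * vrising n x + (-1) * ?s x) \<in> polys_upto n"
    using vrising_in_polys_upto unfolding polys_upto_eq_vspan by (intro vspan_linear)
  then show ?case
    by (simp add: goncarov_rec.simps[of w n])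
qed

text \<open>For fixed \<open>k\<close>, induction on \<open>n\<close> kills all terms of the sum
  except \<open>m = k\<close>, which for \<open>k < n\<close> cancels the mixed difference of
  \<open>vrising n\<close>. For \<open>k = n\<close> that term is absent and 1 remains.\<close>

lemma bdiffs_goncarov_rec: "bdiffs k (goncarov_rec w n) (w k) = (if k = n then 1 else 0)"
proof -
  have eq: "bdiffs k (goncarov_rec w n) = (\<lambda>x. bdiffs k (vrising n) x
      - (\<Sum>m\<in>{m. m < n}. vrising (n - m) (w m) * bdiffs k (goncarov_rec w m) x))" for n
    using bdiffs_linear[of k 1 "vrising n" "-1"
        "\<lambda>x. \<Sum>m\<in>{m. m < n}. vrising (n - m) (w m) * goncarov_rec w m x"]
    by (simp add: goncarov_rec.simps[of w n] bdiffs_sum)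
  show ?thesis
  proof (induction "\<Sum>i\<in>UNIV. n $ i" arbitrary: n rule: less_induct)
    case less
    have "(\<Sum>m\<in>{m. m < n}. vrising (n - m) (w m) * bdiffs k (goncarov_rec w m) (w k)) =
        (\<Sum>m\<in>{m. m < n}. if m = k then vrising (n - k) (w k) else 0)"
      using less by (intro sum.cong) (auto simp: vec_less_imp_sum_less)
    also have "\<dots> = (if k < n then vrising (n - k) (w k) else 0)"
      by (simp add: finite_vec_lessThan)
    finally show ?case
      by (auto simp: eq[of n] bdiffs_vrising order.order_iff_strict)
  qed
qed

lemma vfact_nonzero [simp]: "vfact n \<noteq> 0"
  by (simp add: vfact_def)

lemma goncarov_eq_goncarov_rec: "goncarov n w x = vfact n * goncarov_rec w n x"
proof -
  have "goncarov n w = (\<lambda>x. vfact n * goncarov_rec w n x + 0 * goncarov_rec w n x)"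
  proof (rule goncarov_eqI)
    show "(\<lambda>x. vfact n * goncarov_rec w n x + 0 * goncarov_rec w n x) \<in> polys_upto n"
      using goncarov_rec_in_polys_upto unfolding polys_upto_eq_vspan by (intro vspan_linear)
    show "bdiffs k (\<lambda>x. vfact n * goncarov_rec w n x + 0 * goncarov_rec w n x) (w k) =
        (if k = n then vfact n else 0)" for k
      unfolding bdiffs_linear by (simp add: bdiffs_goncarov_rec)
  qed
  then show ?thesis by simp
qed

text \<open>Differences commute with translations, so the translated polynomial solves the problem
  with translated nodes, and uniqueness applies.\<close>

lemma goncarov_shift:
  assumes "\<And>k. k \<le> n \<Longrightarrow> w k = w' k + v"
  shows "goncarov n w (x + v) = goncarov n w' x"
proof -
  have g: "goncarov n w = (\<lambda>x. vfact n * goncarov_rec w n x + 0 * goncarov_rec w n x)"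
    by (simp add: fun_eq_iff goncarov_eq_goncarov_rec)
  have "goncarov n w' = (\<lambda>x. goncarov n w (x + v))"
  proof (rule goncarov_eqI)
    have "goncarov n w \<in> polys_upto n"
      unfolding g using goncarov_rec_in_polys_upto unfolding polys_upto_eq_vspan by (intro vspan_linear)
    then show "(\<lambda>x. goncarov n w (x + v)) \<in> polys_upto n"
      by (rule polys_upto_shift)
    show "bdiffs k (\<lambda>x. goncarov n w (x + v)) (w' k) = (if k = n then vfact n else 0)"
      if "k \<le> n" for k
      unfolding bdiffs_shift assms[OF that, symmetric] g bdiffs_linear
      by (simp add: bdiffs_goncarov_rec)
  qed
  then show ?thesis by simp
qed

section \<open>Sorted sequences\<close>

definition sorted_lists :: "nat \<Rightarrow> int set \<Rightarrow> int list set" where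
  "sorted_lists l A = {s. length s = l \<and> sorted s \<and> set s \<subseteq> A}"

lemma finite_sorted_lists: "finite A \<Longrightarrow> finite (sorted_lists l A)"
  by (rule finite_subset[OF _ finite_lists_length_eq[of A l]]) (auto simp: sorted_lists_def)

text \<open>Split by the last entry: it is \<open>b\<close>, or it is smaller and sortedness keeps
  all entries below \<open>b\<close>.\<close>

lemma sorted_lists_snoc:
  assumes "a \<le> b"
  shows "sorted_lists (Suc l) {a..<b + 1} =
    sorted_lists (Suc l) {a..<b} \<union> (\<lambda>s. s @ [b]) ` sorted_lists l {a..<b + 1}"
proof (intro equalityI subsetI)
  fix s assume s: "s \<in> sorted_lists (Suc l) {a..<b + 1}"
  then obtain s' y where s': "s = s' @ [y]"
    by (cases s rule: rev_cases) (auto simp: sorted_lists_def)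
  show "s \<in> sorted_lists (Suc l) {a..<b} \<union> (\<lambda>s. s @ [b]) ` sorted_lists l {a..<b + 1}"
  proof (cases "y = b")
    case True
    then show ?thesis
      using s by (auto simp: s' sorted_lists_def sorted_append)
  next
    case False
    then have "y < b"
      using s by (auto simp: s' sorted_lists_def)
    then show ?thesis
      using s by (fastforce simp: s' sorted_lists_def sorted_append)
  qed
next
  fix s assume "s \<in> sorted_lists (Suc l) {a..<b} \<union> (\<lambda>s. s @ [b]) ` sorted_lists l {a..<b + 1}"
  then show "s \<in> sorted_lists (Suc l) {a..<b + 1}"
    using assms by (fastforce simp: sorted_lists_def sorted_append)
qed

text \<open>Double induction on \<open>t\<close> and \<open>l\<close>: the split by the last entry
  is the recursion \<open>rising_diff\<close> at \<open>t + 1\<close>.\<close>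

lemma card_sorted_lists:
  "of_nat (card (sorted_lists l {a..<a + int t})) = rising (of_nat t) l"
proof (induction t arbitrary: l)
  case 0
  have "sorted_lists l {a..<a} = (if l = 0 then {[]} else {})"
    by (auto simp: sorted_lists_def)
  then show ?case
    by (cases l) simp_all
next
  case (Suc t)
  show ?case
  proof (induction l)
    case 0
    have "sorted_lists 0 {a..<a + int (Suc t)} = {[]}"
      by (auto simp: sorted_lists_def)
    then show ?case by simp
  next
    case (Suc l)
    let ?b = "a + int t"
    have "card (sorted_lists (Suc l) {a..<?b + 1}) =
        card (sorted_lists (Suc l) {a..<?b}) + card ((\<lambda>s. s @ [?b]) ` sorted_lists l {a..<?b + 1})"
      unfolding sorted_lists_snoc[of a ?b l, simplified]
      by (rule card_Un_disjoint)
        (simp_all add: finite_sorted_lists, auto simp: sorted_lists_def)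
    also have "card ((\<lambda>s. s @ [?b]) ` sorted_lists l {a..<?b + 1}) = card (sorted_lists l {a..<?b + 1})"
      by (rule card_image) (simp add: inj_on_def)
    finally have "of_nat (card (sorted_lists (Suc l) {a..<?b + 1})) =
        rising (of_nat t) (Suc l) + rising (of_nat (Suc t)) l"
      using Suc \<open>\<And>l. of_nat (card (sorted_lists l {a..<a + int t})) = rising (of_nat t) l\<close>
      by (simp add: algebra_simps)
    also have "\<dots> = rising (of_nat (Suc t)) (Suc l)"
      using rising_diff[of "of_nat (Suc t)" l] by simp
    finally show ?case
      by (simp add: algebra_simps)
  qed
qed

lemma card_sorted_lists':
  "a \<le> b \<Longrightarrow> of_nat (card (sorted_lists l {a..<b})) = rising (of_int (b - a)) l"
  using card_sorted_lists[of l a "nat (b - a)"] by simp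

lemma sequence_tuples_eq_PiE: "sequence_tuples x n = PiE UNIV (\<lambda>i. sorted_lists (n $ i) {0..<x $ i})"
  by (auto simp: sequence_tuples_def sorted_lists_def PiE_def Pi_def)

lemma card_PiE_sorted_lists:
  fixes a b :: "int ^ 'd" and l :: "nat ^ 'd"
  assumes "\<And>i. a $ i \<le> b $ i"
  shows "of_nat (card (PiE UNIV (\<lambda>i. sorted_lists (l $ i) {a $ i..<b $ i}))) = vrising l (rvec (b - a))"
  using assms by (simp add: card_PiE vrising_def rvec_def card_sorted_lists')

section \<open>Reachable lattice points\<close>

text \<open>Whether a step is allowed depends only on its starting point and direction, so paths can
  be replaced by an inductive predicate on their endpoints.\<close>

inductive reachable :: "(nat ^ 'd \<Rightarrow> int ^ 'd) \<Rightarrow> ('d \<Rightarrow> int list) \<Rightarrow> nat ^ 'd \<Rightarrow> bool"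
  for U a where
  origin: "reachable U a 0"
| step: "reachable U a k \<Longrightarrow> a i ! (k $ i) < U k $ i \<Longrightarrow> reachable U a (k + axis i 1)"

lemma bounded_by_snoc:
  "bounded_by (P @ [axis i 1]) U a \<longleftrightarrow>
    bounded_by P U a \<and> a i ! (sum_list P $ i) < U (sum_list P) $ i"
  by (auto simp: bounded_by_def Let_def nth_append axis_eq_axis less_Suc_eq)

lemma reachable_iff: "reachable U a m \<longleftrightarrow> (\<exists>P\<in>lattice_paths m. bounded_by P U a)"
proof
  assume "reachable U a m"
  then show "\<exists>P\<in>lattice_paths m. bounded_by P U a"
  proof induction
    case origin
    show ?case
      by (rule bexI[of _ "[]"]) (auto simp: lattice_paths_def bounded_by_def)
  next
    case (step k i)
    then obtain P where "P \<in> lattice_paths k" "bounded_by P U a"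
      by blast
    with step show ?case
      by (intro bexI[of _ "P @ [axis i 1]"]) (auto simp: lattice_paths_def bounded_by_snoc simp del: One_nat_def)
  qed
next
  have "reachable U a (sum_list P)" if "set P \<subseteq> range (\<lambda>i. axis i 1)" "bounded_by P U a" for P
    using that
  proof (induction P rule: rev_induct)
    case Nil
    show ?case by (simp add: origin)
  next
    case (snoc s P)
    then show ?case
      by (auto simp: bounded_by_snoc simp del: One_nat_def intro: step)
  qed
  then show "\<exists>P\<in>lattice_paths m. bounded_by P U a \<Longrightarrow> reachable U a m"
    by (auto simp: lattice_paths_def)
qed

lemma le_add_axis: "k \<le> k + axis i (1::nat)"
  by (simp add: less_eq_vec_def)

text \<open>A path to \<open>m\<close> reads the \<open>i\<close>-th list only at positions below
  \<open>m $ i\<close>. This permits cutting a tuple at \<open>m\<close> or replacing what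
  follows.\<close>

lemma reachable_cong:
  assumes "reachable U a m" "\<And>i j. j < m $ i \<Longrightarrow> a i ! j = b i ! j"
  shows "reachable U b m"
  using assms
proof induction
  case origin
  show ?case by (rule reachable.origin)
next
  case (step k i)
  have "a i ! (k $ i) = b i ! (k $ i)"
    by (rule step.prems) (simp add: axis_def)
  moreover have "reachable U b k"
    by (rule step.IH, rule step.prems) (simp add: trans_less_add1)
  ultimately show ?case
    using step.hyps(2) by (intro reachable.step) simp_all
qed

locale monotone_bounds =
  fixes n :: "nat ^ 'd" and U :: "nat ^ 'd \<Rightarrow> int ^ 'd"
  assumes mono: "k \<le> k' \<Longrightarrow> k' \<le> n \<Longrightarrow> U k $ i \<le> U k' $ i"
begin

text \<open>Each position below \<open>m $ i\<close> is read by some step of the path, and the bound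
  met there persists because \<open>U\<close> grows along the path.\<close>

lemma reachable_entry_less:
  assumes "reachable U a m" "m \<le> n" "j < m $ i"
  shows "a i ! j < U m $ i"
  using assms
proof (induction arbitrary: j i)
  case origin
  then show ?case by simp
next
  case (step k l)
  have "a i ! j < U k $ i"
  proof (cases "j < k $ i")
    case True
    then show ?thesis
      using step.IH step.prems(1) le_add_axis order_trans by blast
  next
    case False
    then have "l = i" "j = k $ i"
      using step.prems(2) by (auto simp: axis_def split: if_splits)
    then show ?thesis
      using step.hyps(2) by simp
  qed
  also have "\<dots> \<le> U (k + axis l 1) $ i"
    by (intro mono le_add_axis step.prems)
  finally show ?case .
qed

definition stuck :: "('d \<Rightarrow> int list) \<Rightarrow> nat ^ 'd \<Rightarrow> bool" where
  "stuck a m \<longleftrightarrow> (\<forall>i. m $ i < n $ i \<longrightarrow> U m $ i \<le> a i ! (m $ i))"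

text \<open>The first step out of the box below \<open>m\<close> would start at some
  \<open>k \<le> m\<close> with \<open>k $ i = m $ i\<close> and read an entry below
  \<open>U k $ i \<le> U m $ i\<close>, which \<open>stuck\<close> forbids. So a reachable stuck
  point is the greatest reachable one below \<open>n\<close>.\<close>

lemma reachable_le_stuck:
  assumes "reachable U a k" "k \<le> n" "stuck a m" "m \<le> n"
  shows "k \<le> m"
  using assms(1,2)
proof induction
  case origin
  show ?case by (simp add: less_eq_vec_def)
next
  case (step k i)
  then have "k \<le> m"
    using le_add_axis order_trans by blast
  have "k $ i < n $ i"
    using step.prems by (auto simp: less_eq_vec_def axis_def dest: spec[of _ i])
  have "k $ i \<noteq> m $ i"
  proof
    assume eq: "k $ i = m $ i"
    then have "U m $ i \<le> a i ! (m $ i)"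
      using assms(3) \<open>k $ i < n $ i\<close> by (simp add: stuck_def)
    also have "\<dots> < U k $ i"
      using step.hyps(2) eq by simp
    also have "\<dots> \<le> U m $ i"
      by (intro mono \<open>k \<le> m\<close> assms(4))
    finally show False by simp
  qed
  moreover have "k $ j \<le> m $ j" for j
    using \<open>k \<le> m\<close> by (simp add: less_eq_vec_def)
  ultimately show ?case
    by (auto simp: less_eq_vec_def axis_def Suc_le_eq intro: le_neq_implies_less)
qed

text \<open>A reachable point below \<open>n\<close> of largest coordinate sum works: a further
  allowed step would increase the sum.\<close>

lemma ex_stuck:
  obtains m where "m \<le> n" "reachable U a m" "stuck a m"
proof -
  let ?S = "{m. m \<le> n \<and> reachable U a m}"
  let ?s = "\<lambda>m :: nat ^ 'd. \<Sum>i\<in>UNIV. m $ i"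
  have fin: "finite ?S"
    using finite_vec_atMost[of n] by (rule rev_finite_subset) auto
  have "0 \<in> ?S"
    by (simp add: reachable.origin less_eq_vec_def)
  then have "Max (?s ` ?S) \<in> ?s ` ?S"
    using fin by (intro Max_in) auto
  then obtain m where m: "m \<in> ?S" "?s m = Max (?s ` ?S)"
    by auto
  have "stuck a m"
    unfolding stuck_def
  proof (intro allI impI, rule ccontr)
    fix i assume i: "m $ i < n $ i" "\<not> U m $ i \<le> a i ! (m $ i)"
    have "m + axis i 1 \<le> n"
      using m(1) i(1) by (auto simp: less_eq_vec_def axis_def)
    then have "m + axis i 1 \<in> ?S"
      using m(1) i(2) by (auto intro: reachable.step simp del: One_nat_def)
    then have "?s (m + axis i 1) \<le> ?s m"
      unfolding m(2) using fin by (intro Max_ge finite_imageI imageI)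
    moreover have "m < m + axis i 1"
      by (simp add: less_vec_def less_eq_vec_def axis_def exI[of _ i])
    ultimately show False
      using vec_less_imp_sum_less[of m "m + axis i 1"] by simp
  qed
  with m(1) show thesis
    using that by blast
qed

section \<open>Decomposition of tuples at their greatest reachable point\<close>

definition reachable_tuples :: "int ^ 'd \<Rightarrow> nat ^ 'd \<Rightarrow> ('d \<Rightarrow> int list) set" where
  "reachable_tuples x m = {a \<in> sequence_tuples x m. reachable U a m}"

definition stuck_tuples :: "int ^ 'd \<Rightarrow> nat ^ 'd \<Rightarrow> ('d \<Rightarrow> int list) set" where
  "stuck_tuples x m = {a \<in> sequence_tuples x n. reachable U a m \<and> stuck a m}"

lemma finite_sequence_tuples: "finite (sequence_tuples x m)"
  unfolding sequence_tuples_eq_PiE by (intro finite_PiE) (auto simp: finite_sorted_lists)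

lemma finite_stuck_tuples: "finite (stuck_tuples x m)"
  using finite_sequence_tuples[of x n] by (simp add: stuck_tuples_def)

text \<open>The sets \<open>stuck_tuples x m\<close> form a partition: \<open>ex_stuck\<close> gives
  covering, and \<open>reachable_le_stuck\<close> applied both ways gives disjointness.\<close>

lemma card_sequence_tuples:
  "card (sequence_tuples x n) = (\<Sum>m\<in>{m. m \<le> n}. card (stuck_tuples x m))"
proof -
  have "sequence_tuples x n = (\<Union>m\<in>{m. m \<le> n}. stuck_tuples x m)"
    unfolding stuck_tuples_def using ex_stuck by blast
  moreover have "disjoint_family_on (stuck_tuples x) {m. m \<le> n}"
    unfolding disjoint_family_on_def stuck_tuples_def
    using reachable_le_stuck by (auto intro!: order.antisym)
  ultimately show ?thesis
    by (simp add: card_UN_disjoint' finite_vec_atMost finite_stuck_tuples)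
qed

text \<open>Cut at \<open>m\<close>. By \<open>reachable_entry_less\<close> the entries before the
  cut lie below \<open>U m $ i\<close>, so every sorted tail with entries from
  \<open>U m $ i\<close> on may follow; conversely \<open>stuck\<close> bounds the first entry of
  each tail from below and sortedness the others.\<close>

lemma bij_betw_stuck_tuples:
  assumes "m \<le> n" and pos: "\<And>i. 0 \<le> U m $ i" and le: "\<And>i. U m $ i \<le> x $ i"
  shows "bij_betw (\<lambda>(b, c) i. b i @ c i)
    (reachable_tuples x m \<times> PiE UNIV (\<lambda>i. sorted_lists ((n - m) $ i) {U m $ i..<x $ i}))
    (stuck_tuples x m)"
proof (rule bij_betw_byWitness[where f' = "\<lambda>a. (\<lambda>i. take (m $ i) (a i), \<lambda>i. drop (m $ i) (a i))"])
  let ?C = "PiE UNIV (\<lambda>i. sorted_lists ((n - m) $ i) {U m $ i..<x $ i})"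
  have mn: "m $ i \<le> n $ i" for i
    using assms(1) by (simp add: less_eq_vec_def)
  show "\<forall>p\<in>reachable_tuples x m \<times> ?C.
      (\<lambda>a. (\<lambda>i. take (m $ i) (a i), \<lambda>i. drop (m $ i) (a i))) ((\<lambda>(b, c) i. b i @ c i) p) = p"
    by (auto simp: reachable_tuples_def sequence_tuples_def)
  show "\<forall>a\<in>stuck_tuples x m.
      (\<lambda>(b, c) i. b i @ c i) (\<lambda>i. take (m $ i) (a i), \<lambda>i. drop (m $ i) (a i)) = a"
    by simp
  show "(\<lambda>(b, c) i. b i @ c i) ` (reachable_tuples x m \<times> ?C) \<subseteq> stuck_tuples x m"
  proof (clarify)
    fix b c assume b: "b \<in> reachable_tuples x m" and c: "c \<in> ?C"
    have len: "length (b i) = m $ i" "length (c i) = n $ i - m $ i" for i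
      using b c by (auto simp: reachable_tuples_def sequence_tuples_def sorted_lists_def)
    have bU: "y < U m $ i" if "y \<in> set (b i)" for i y
      using that b reachable_entry_less[of b m _ i] assms(1)
      by (auto simp: in_set_conv_nth reachable_tuples_def len)
    have cU: "U m $ i \<le> y" if "y \<in> set (c i)" for i y
      using that PiE_mem[OF c, of i] by (auto simp: sorted_lists_def)
    have "sorted (b i @ c i)" for i
      using b PiE_mem[OF c, of i] bU[of _ i] cU[of _ i]
      by (fastforce simp: sorted_append reachable_tuples_def sequence_tuples_def sorted_lists_def)
    moreover have "set (b i @ c i) \<subseteq> {0..<x $ i}" for i
      using b PiE_mem[OF c, of i] pos[of i]
      by (fastforce simp: reachable_tuples_def sequence_tuples_def sorted_lists_def)
    ultimately have "(\<lambda>i. b i @ c i) \<in> sequence_tuples x n"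
      using mn by (simp add: sequence_tuples_def len)
    moreover have "reachable U (\<lambda>i. b i @ c i) m"
      using b by (auto intro: reachable_cong simp: reachable_tuples_def nth_append len)
    moreover have "stuck (\<lambda>i. b i @ c i) m"
      unfolding stuck_def using cU by (auto simp: nth_append len)
    ultimately show "(\<lambda>i. b i @ c i) \<in> stuck_tuples x m"
      by (simp add: stuck_tuples_def)
  qed
  show "(\<lambda>a. (\<lambda>i. take (m $ i) (a i), \<lambda>i. drop (m $ i) (a i))) ` stuck_tuples x m
      \<subseteq> reachable_tuples x m \<times> ?C"
  proof (clarify, intro conjI)
    fix a assume "a \<in> stuck_tuples x m"
    then have a: "\<And>i. length (a i) = n $ i" "\<And>i. sorted (a i)" "\<And>i. set (a i) \<subseteq> {0..<x $ i}"
      and r: "reachable U a m" and s: "stuck a m"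
      by (auto simp: stuck_tuples_def sequence_tuples_def)
    have "reachable U (\<lambda>i. take (m $ i) (a i)) m"
      using r by (rule reachable_cong) simp
    moreover have "set (take (m $ i) (a i)) \<subseteq> {0..<x $ i}" for i
      using a(3) set_take_subset by (rule order_trans[rotated])
    ultimately show "(\<lambda>i. take (m $ i) (a i)) \<in> reachable_tuples x m"
      using a(1,2) mn by (simp add: reachable_tuples_def sequence_tuples_def sorted_wrt_take)
    have "U m $ i \<le> y" if y: "y \<in> set (drop (m $ i) (a i))" for i y
    proof -
      obtain j where j: "m $ i + j < n $ i" "y = a i ! (m $ i + j)"
        using y by (auto simp: in_set_conv_nth a(1) less_diff_conv add.commute)
      then have "U m $ i \<le> a i ! (m $ i)"
        using s by (simp add: stuck_def)
      also have "\<dots> \<le> y"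
        unfolding j(2) using j(1) a(1,2) by (intro sorted_nth_mono) auto
      finally show ?thesis .
    qed
    moreover have "y < x $ i" if "y \<in> set (drop (m $ i) (a i))" for i y
      using a(3)[of i] in_set_dropD[OF that] by auto
    ultimately show "(\<lambda>i. drop (m $ i) (a i)) \<in> ?C"
      using a(1,2) by (auto simp: sorted_lists_def sorted_wrt_drop)
  qed
qed

text \<open>Double counting of all tuples: once as a product of sets of sorted lists, once by the
  greatest reachable point \<open>m\<close>, where the free tails give the factor with
  \<open>vrising (n - m)\<close>.\<close>

lemma vrising_eq_sum_reachable_tuples:
  assumes "\<And>i. 0 < x $ i" and "\<And>k i. k \<le> n \<Longrightarrow> 0 \<le> U k $ i \<and> U k $ i \<le> x $ i"
  shows "vrising n (rvec x) =
    (\<Sum>m\<in>{m. m \<le> n}. vrising (n - m) (rvec (x - U m)) * of_nat (card (reachable_tuples x m)))"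
proof -
  have "vrising n (rvec x) = of_nat (card (sequence_tuples x n))"
    using card_PiE_sorted_lists[of 0 x n] assms(1)
    by (simp add: sequence_tuples_eq_PiE less_imp_le)
  also have "\<dots> = (\<Sum>m\<in>{m. m \<le> n}. of_nat (card (stuck_tuples x m)))"
    by (simp add: card_sequence_tuples)
  also have "\<dots> = (\<Sum>m\<in>{m. m \<le> n}.
      vrising (n - m) (rvec (x - U m)) * of_nat (card (reachable_tuples x m)))"
  proof (rule sum.cong)
    fix m assume "m \<in> {m. m \<le> n}"
    then have m: "m \<le> n" by simp
    have "card (stuck_tuples x m) = card (reachable_tuples x m) *
        card (PiE UNIV (\<lambda>i. sorted_lists ((n - m) $ i) {U m $ i..<x $ i}))"
      using bij_betw_same_card[OF bij_betw_stuck_tuples[OF m]] assms(2)[OF m]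
      by (simp add: card_cartesian_product)
    then show "of_nat (card (stuck_tuples x m)) =
        vrising (n - m) (rvec (x - U m)) * of_nat (card (reachable_tuples x m))"
      using card_PiE_sorted_lists[of "U m" x "n - m"] assms(2)[OF m] by simp
  qed simp
  finally show ?thesis .
qed

end

text \<open>The counts and \<open>goncarov_rec\<close> satisfy the same triangular recursion. The
  bounds are an assumption instead of a locale context because the induction passes to smaller
  \<open>n\<close>.\<close>

lemma card_reachable_tuples:
  assumes "monotone_bounds n U" and "\<And>i. 0 < x $ i"
    and "\<And>k i. k \<le> n \<Longrightarrow> 0 \<le> U k $ i \<and> U k $ i \<le> x $ i"
  shows "of_nat (card {a \<in> sequence_tuples x n. reachable U a n}) =
    goncarov_rec (\<lambda>k. rvec (x - U k)) n (rvec x)"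
  using assms
proof (induction "\<Sum>i\<in>UNIV. n $ i" arbitrary: n rule: less_induct)
  case less
  let ?w = "\<lambda>k. rvec (x - U k)"
  interpret monotone_bounds n U
    by (rule less.prems)
  have split: "{m. m \<le> n} = insert n {m. m < n}"
    by auto
  have "(\<Sum>m\<in>{m. m < n}. vrising (n - m) (?w m) * of_nat (card (reachable_tuples x m))) =
      (\<Sum>m\<in>{m. m < n}. vrising (n - m) (?w m) * goncarov_rec ?w m (rvec x))"
  proof (rule sum.cong)
    fix m assume "m \<in> {m. m < n}"
    then have m: "m < n" by simp
    have "monotone_bounds m U"
      using mono m by unfold_locales (meson order.strict_implies_order order_trans)
    moreover have "0 \<le> U k $ i \<and> U k $ i \<le> x $ i" if "k \<le> m" for k i
      using less.prems(3) that m by (meson order.strict_implies_order order_trans)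
    ultimately show "vrising (n - m) (?w m) * of_nat (card (reachable_tuples x m)) =
        vrising (n - m) (?w m) * goncarov_rec ?w m (rvec x)"
      using less.hyps[OF vec_less_imp_sum_less[OF m]] less.prems(2) by (simp add: reachable_tuples_def)
  qed simp
  \<comment> \<open>Both full sums equal \<open>vrising n (rvec x)\<close>; removing the equal parts
    over \<open>m < n\<close> leaves the terms at \<open>n\<close>, where the factor is 1.\<close>
  moreover have "(\<Sum>m\<in>{m. m \<le> n}. vrising (n - m) (?w m) * of_nat (card (reachable_tuples x m))) =
      (\<Sum>m\<in>{m. m \<le> n}. vrising (n - m) (?w m) * goncarov_rec ?w m (rvec x))"
    using vrising_eq_sum_reachable_tuples[OF less.prems(2,3)] goncarov_rec_sum[of n "rvec x" ?w]
    by (rule trans[OF sym])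
  ultimately show ?case
    by (simp add: split finite_vec_lessThan reachable_tuples_def)
qed

theorem theorem15:
  fixes x :: "int ^ 'd" and n :: "nat ^ 'd" and z U :: "nat ^ 'd \<Rightarrow> int ^ 'd"
  assumes x_pos: "\<And>i. 0 < x $ i"
    and z_range: "\<And>k i. k \<le> n \<Longrightarrow> 0 \<le> z k $ i \<and> z k $ i < x $ i"
    and z_antimono: "\<And>k k' i. k \<le> k' \<Longrightarrow> k' \<le> n \<Longrightarrow> z k' $ i \<le> z k $ i"
    and U_eq: "\<And>k. k \<le> n \<Longrightarrow> U k = x - z k"
  shows "of_nat (card (\<Union>P\<in>lattice_paths n. bounded_tuples x n P U)) =
           1 / vfact n * goncarov n (\<lambda>k. rvec (z k)) (rvec x) \<and>
         1 / vfact n * goncarov n (\<lambda>k. rvec (z k)) (rvec x) =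
           1 / vfact n * goncarov n (\<lambda>k. rvec (- U k)) 0"
proof -
  have "monotone_bounds n U"
  proof
    fix k k' i assume "k \<le> k'" "k' \<le> n"
    moreover from this have "k \<le> n" by (rule order_trans)
    ultimately show "U k $ i \<le> U k' $ i"
      using z_antimono[of k k' i] by (simp add: U_eq)
  qed
  moreover have "0 \<le> U k $ i \<and> U k $ i \<le> x $ i" if "k \<le> n" for k i
    using z_range[OF that, of i] by (simp add: U_eq[OF that])
  moreover have "(\<Union>P\<in>lattice_paths n. bounded_tuples x n P U) =
      {a \<in> sequence_tuples x n. reachable U a n}"
    by (auto simp: bounded_tuples_def reachable_iff)
  ultimately have card: "of_nat (card (\<Union>P\<in>lattice_paths n. bounded_tuples x n P U)) =
      goncarov_rec (\<lambda>k. rvec (x - U k)) n (rvec x)"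
    using card_reachable_tuples[of n U x] x_pos by simp
  \<comment> \<open>For \<open>k \<le> n\<close> both \<open>x - U k\<close> and \<open>z k\<close>
    are the translate of \<open>- U k\<close> by \<open>x\<close>, so translating to the origin
    identifies the two node families and also gives the second equality.\<close>
  have "rvec (x - U k) = rvec (- U k) + rvec x" "rvec (z k) = rvec (- U k) + rvec x" if "k \<le> n" for k
    by (simp_all add: rvec_def vec_eq_iff U_eq[OF that])
  then have shift: "goncarov n (\<lambda>k. rvec (x - U k)) (rvec x) = goncarov n (\<lambda>k. rvec (- U k)) 0"
    "goncarov n (\<lambda>k. rvec (z k)) (rvec x) = goncarov n (\<lambda>k. rvec (- U k)) 0"
    using goncarov_shift[of n _ "\<lambda>k. rvec (- U k)" "rvec x" 0] by simp_all
  have "goncarov_rec (\<lambda>k. rvec (x - U k)) n (rvec x) =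
      1 / vfact n * goncarov n (\<lambda>k. rvec (x - U k)) (rvec x)"
    by (simp add: goncarov_eq_goncarov_rec)
  then show ?thesis
    unfolding card by (simp add: shift)
qed

end
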